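(* Let $d\ge 3$ be an integer, let $a>0$ and $b$ be real numbers, and let $$\mathcal{P}_0:=\Big\{x\in\mathbb{R}^d : x_i\le b\ (i=1,\ldots,d),\ \sum_{i=1}^dx_i\ge db-a\Big\},$$ $$\mathcal{P}_1:=\Big\{x\in\mathbb{R}^d : x_i\ge 0\ (i=1,\ldots,d),\ \sum_{i=1}^dx_i\le a\Big\}.$$ Then $\mathcal{D}\subset\mathbb{R}^{d+1}$ is exactly the set of points $\begin{pmatrix}x\\ z_1\end{pmatrix}$ satisfying all of the following inequalities: (i) the full optimal big-M lifting of each facet-describing inequality of each of $\mathcal{P}_0$ and $\mathcal{P}_1$; (ii) $0\le z_1\le 1$; (iii) $-\sum_{i\in T_0}x_i+(a-(d+1-m)b)z_1\le a-(d+1-m)b$, for all $m$ with $2\le m\le d-1$ and all $T_0\subseteq\{1,\ldots,d\}$ with $|T_0|=d+1-m$; (iv) $\sum_{i\in T_1}x_i+(mb-a)z_1\le mb$, for all $m$ with $2\le m\le d-1$ and all $T_1\subseteq\{1,\ldots,d\}$ with $|T_1|=m$.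
   Context: Points of $\mathbb{R}^{d+1}$ are written $\begin{pmatrix}x\\ z_1\end{pmatrix}$ with $x\in\mathbb{R}^d$, $z_1\in\mathbb{R}$, and $$\mathcal{D}:=\operatorname{conv}\left(\left\{\begin{pmatrix}x\\ 0\end{pmatrix} : x\in\mathcal{P}_0\right\}\cup\left\{\begin{pmatrix}x\\ 1\end{pmatrix} : x\in\mathcal{P}_1\right\}\right)\subset\mathbb{R}^{d+1}.$$ A facet-describing inequality of a polytope is a valid inequality such that the set of points of the polytope satisfying it with equality is a facet (a face of dimension one less than that of the polytope). Full optimal big-M lifting (two polytopes): if $\alpha^\top x\le\beta$ is valid for $\mathcal{P}_0$, put $M_1:=\min\{\beta-\alpha^\top x : x\in\mathcal{P}_1\}$, and its full optimal big-M lifting is $\alpha^\top x+M_1z_1\le\beta$. If $\alpha^\top x\le\beta$ is valid for $\mathcal{P}_1$, put $M_0:=\min\{\beta-\alpha^\top x : x\in\mathcal{P}_0\}$, and its full optimal big-M lifting is $\alpha^\top x-M_0z_1\le\beta-M_0$. *)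

theory Defs
  imports "HOL-Analysis.Analysis"
begin

text \<open>
  \<open>\<real>\<^sup>d\<close> is rendered as \<open>real ^ 'n\<close> with \<open>d = CARD('n)\<close>, and \<open>\<real>\<^sup>d\<^sup>+\<^sup>1\<close> as \<open>(real ^ 'n) \<times> real\<close>,
  the second component being \<open>z\<^sub>1\<close>.
\<close>

definition P0 :: "real \<Rightarrow> real \<Rightarrow> (real ^ 'n) set"
  where "P0 a b = {x. (\<forall>i. x $ i \<le> b) \<and> (\<Sum>i\<in>UNIV. x $ i) \<ge> real CARD('n) * b - a}"

definition P1 :: "real \<Rightarrow> (real ^ 'n) set"
  where "P1 a = {x. (\<forall>i. x $ i \<ge> 0) \<and> (\<Sum>i\<in>UNIV. x $ i) \<le> a}"

definition disj_hull :: "'a::euclidean_space set \<Rightarrow> 'a set \<Rightarrow> ('a \<times> real) set"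
  where "disj_hull A B = convex hull ({(x, 0) | x. x \<in> A} \<union> {(x, 1) | x. x \<in> B})"

definition valid_ineq :: "'a::euclidean_space set \<Rightarrow> 'a \<Rightarrow> real \<Rightarrow> bool"
  where "valid_ineq P \<alpha> \<beta> \<longleftrightarrow> (\<forall>x\<in>P. \<alpha> \<bullet> x \<le> \<beta>)"

text \<open>
  The library's \<open>facet_of\<close> also demands that the facet be nonempty; this only
  matters for polytopes consisting of a single point.
\<close>

definition facet_describing :: "'a::euclidean_space set \<Rightarrow> 'a \<Rightarrow> real \<Rightarrow> bool"
  where "facet_describing P \<alpha> \<beta> \<longleftrightarrow> valid_ineq P \<alpha> \<beta> \<and> {x \<in> P. \<alpha> \<bullet> x = \<beta>} facet_of P"

text \<open>
  For a nonempty polytope \<open>Q\<close> the infimum is attained, so this is the minimum of the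
  slack \<open>\<beta> - \<alpha>\<^sup>T x\<close> over \<open>Q\<close>.
\<close>

definition opt_M :: "'a::euclidean_space set \<Rightarrow> 'a \<Rightarrow> real \<Rightarrow> real"
  where "opt_M Q \<alpha> \<beta> = (INF x\<in>Q. \<beta> - \<alpha> \<bullet> x)"

text \<open>
  The points satisfying the full optimal big-M lifting of \<open>\<alpha>\<^sup>T x \<le> \<beta>\<close>, for an inequality
  valid for the polytope at height 0 (resp. 1); \<open>Q\<close> is the \<^emph>\<open>other\<close> polytope.
\<close>

definition big_M_lifting0 :: "'a::euclidean_space set \<Rightarrow> 'a \<Rightarrow> real \<Rightarrow> ('a \<times> real) set"
  where "big_M_lifting0 Q \<alpha> \<beta> = {(x, z\<^sub>1). \<alpha> \<bullet> x + opt_M Q \<alpha> \<beta> * z\<^sub>1 \<le> \<beta>}"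

definition big_M_lifting1 :: "'a::euclidean_space set \<Rightarrow> 'a \<Rightarrow> real \<Rightarrow> ('a \<times> real) set"
  where "big_M_lifting1 Q \<alpha> \<beta> = {(x, z\<^sub>1). \<alpha> \<bullet> x - opt_M Q \<alpha> \<beta> * z\<^sub>1 \<le> \<beta> - opt_M Q \<alpha> \<beta>}"

end

theory Submission
  imports Defs
begin

text \<open>
  Both polytopes are corner simplices of size \<open>a\<close>: with \<open>b\<close> also denoting the constant vector,
  \<open>P\<^sub>1\<close> consists of the \<open>v \<ge> 0\<close> with \<open>\<Sum>\<^sub>i v\<^sub>i \<le> a\<close>, and \<open>P\<^sub>0\<close> of the points \<open>b - u\<close> with
  \<open>u \<ge> 0\<close> and \<open>\<Sum>\<^sub>i u\<^sub>i \<le> a\<close>.  Hence \<open>(x, z)\<close> with \<open>0 \<le> z \<le> 1\<close> lies in the hull iff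
  \<open>y = x - (1 - z) b\<close> can be written as \<open>v - u\<close> with \<open>u, v \<ge> 0\<close>, \<open>\<Sum>\<^sub>i u\<^sub>i \<le> (1 - z) a\<close> and
  \<open>\<Sum>\<^sub>i v\<^sub>i \<le> z a\<close>.  The most economical such decomposition takes for \<open>v\<close> and \<open>u\<close> the positive
  and negative parts of \<open>y\<close>.  The sum of the positive parts is the maximum over all index sets
  \<open>T\<close> of \<open>\<Sum>\<^sub>i\<^sub>\<in>\<^sub>T y\<^sub>i\<close>, and similarly for the negative parts.  So the hull is described by the
  inequalities \<open>\<Sum>\<^sub>i\<^sub>\<in>\<^sub>T y\<^sub>i \<le> z a\<close> and \<open>-\<Sum>\<^sub>i\<^sub>\<in>\<^sub>T y\<^sub>i \<le> (1 - z) a\<close> for all \<open>T\<close>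
  (lemma \<open>in_disj_hull_if_subset_sums\<close>).

  Sorted by the size of \<open>T\<close>, these are the inequalities of the theorem.  Since \<open>a > 0\<close>, the empty
  set gives \<open>0 \<le> z \<le> 1\<close>, and the sizes strictly between \<open>1\<close> and \<open>d\<close> give the two families of
  subset-sum inequalities.  The extreme sizes come from the facets of the simplices:  the facets
  \<open>x\<^sub>i \<le> b\<close> and \<open>\<Sum>\<^sub>i x\<^sub>i \<ge> d b - a\<close> of \<open>P\<^sub>0\<close> lift to the upper bounds for singletons and the lower
  bound for the full set, and the facets \<open>x\<^sub>i \<ge> 0\<close> and \<open>\<Sum>\<^sub>i x\<^sub>i \<le> a\<close> of \<open>P\<^sub>1\<close> lift to the lower bounds
  for singletons and the upper bound for the full set.  For this it has to be verified that these
  inequalities do describe facets (\<open>facet_describing_P0\<close>, \<open>facet_describing_P1\<close>), and the optimal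
  big-M coefficients have to be bounded from below (\<open>big_M_lifting0D\<close>, \<open>big_M_lifting1D\<close>).

  Conversely, a linear inequality holds on the hull as soon as it holds on the two pieces
  (\<open>disj_hull_linear_le\<close>), which makes all the listed inequalities valid.
\<close>

section \<open>Linear inequalities on the hull of two sets\<close>

text \<open>
  The bounds at the two heights combine to one inequality that is linear in \<open>(x, z)\<close>, so that it
  cuts out a convex set containing both pieces.
\<close>

lemma disj_hull_linear_le:
  fixes f :: "'a::euclidean_space \<Rightarrow> real"
  assumes "(x, z) \<in> disj_hull A B" and f: "linear f"
    and A: "\<And>p. p \<in> A \<Longrightarrow> f p \<le> \<beta>\<^sub>0" and B: "\<And>q. q \<in> B \<Longrightarrow> f q \<le> \<beta>\<^sub>1"
  shows "f x \<le> (1 - z) * \<beta>\<^sub>0 + z * \<beta>\<^sub>1"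
proof -
  define g where "g = (\<lambda>p :: 'a \<times> real. f (fst p) + (\<beta>\<^sub>0 - \<beta>\<^sub>1) * snd p)"
  have "linear g"
    unfolding g_def by (rule linearI) (simp_all add: linear_add[OF f] linear_cmul[OF f] algebra_simps)
  then have "convex (g -` {..\<beta>\<^sub>0})"
    by (rule convex_linear_vimage) simp
  then have "disj_hull A B \<subseteq> g -` {..\<beta>\<^sub>0}"
    unfolding disj_hull_def using A B by (intro hull_minimal) (fastforce simp: g_def)+
  then have "g (x, z) \<le> \<beta>\<^sub>0"
    using assms(1) by auto
  then show ?thesis
    by (simp add: g_def algebra_simps)
qed

lemma in_disj_hullI:
  assumes "p \<in> A" "q \<in> B" "0 \<le> z" "z \<le> 1"
  shows "((1 - z) *\<^sub>R p + z *\<^sub>R q, z) \<in> disj_hull A B"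
proof -
  let ?S = "{(x, 0::real) | x. x \<in> A} \<union> {(x, 1) | x. x \<in> B}"
  have "(1 - z) *\<^sub>R (p, 0) + z *\<^sub>R (q, 1) \<in> convex hull ?S"
    using assms by (intro convexD[OF convex_convex_hull]) (auto intro: hull_inc)
  then show ?thesis
    by (simp add: disj_hull_def)
qed

section \<open>Big-M liftings\<close>

lemma opt_M_le:
  assumes "bounded Q" "q \<in> Q"
  shows "opt_M Q \<alpha> \<beta> \<le> \<beta> - \<alpha> \<bullet> q"
  unfolding opt_M_def
proof (rule cINF_lower[OF _ assms(2)])
  have "bounded ((\<lambda>x. \<alpha> \<bullet> x) ` Q)"
    by (rule bounded_linear_image[OF assms(1) bounded_linear_inner_right])
  then obtain K where "\<And>x. x \<in> Q \<Longrightarrow> \<bar>\<alpha> \<bullet> x\<bar> \<le> K"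
    by (auto simp: bounded_real)
  then show "bdd_below ((\<lambda>x. \<beta> - \<alpha> \<bullet> x) ` Q)"
    by (intro bdd_belowI2[of _ "\<beta> - K"]) (fastforce simp: abs_le_iff)
qed

lemma opt_M_ge:
  assumes "Q \<noteq> {}" "\<And>q. q \<in> Q \<Longrightarrow> \<alpha> \<bullet> q \<le> \<gamma>"
  shows "\<beta> - \<gamma> \<le> opt_M Q \<alpha> \<beta>"
  unfolding opt_M_def using assms by (intro cINF_greatest) auto

text \<open>
  At the height of its own polytope the lifted inequality restricts to \<open>\<alpha>\<^sup>T x \<le> \<beta>\<close>.  At the height
  of the other one it reads \<open>\<alpha>\<^sup>T x \<le> \<beta> - M\<close> with the optimal coefficient \<open>M\<close>, which holds because
  \<open>M\<close> is a lower bound of the slack there.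
\<close>

lemma disj_hull_big_M_lifting0:
  assumes "(x, z) \<in> disj_hull A B" "valid_ineq A \<alpha> \<beta>" "bounded B"
  shows "(x, z) \<in> big_M_lifting0 B \<alpha> \<beta>"
proof -
  have "\<alpha> \<bullet> x \<le> (1 - z) * \<beta> + z * (\<beta> - opt_M B \<alpha> \<beta>)"
    using assms(2) opt_M_le[OF assms(3), of _ \<alpha> \<beta>]
    by (intro disj_hull_linear_le[OF assms(1)])
       (auto simp: valid_ineq_def le_diff_eq add.commute bounded_linear.linear[OF bounded_linear_inner_right])
  then show ?thesis
    by (simp add: big_M_lifting0_def algebra_simps)
qed

lemma disj_hull_big_M_lifting1:
  assumes "(x, z) \<in> disj_hull A B" "valid_ineq B \<alpha> \<beta>" "bounded A"
  shows "(x, z) \<in> big_M_lifting1 A \<alpha> \<beta>"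
proof -
  have "\<alpha> \<bullet> x \<le> (1 - z) * (\<beta> - opt_M A \<alpha> \<beta>) + z * \<beta>"
    using assms(2) opt_M_le[OF assms(3), of _ \<alpha> \<beta>]
    by (intro disj_hull_linear_le[OF assms(1)])
       (auto simp: valid_ineq_def le_diff_eq add.commute bounded_linear.linear[OF bounded_linear_inner_right])
  then show ?thesis
    by (simp add: big_M_lifting1_def algebra_simps)
qed

text \<open>
  The coefficient is multiplied by \<open>z \<ge> 0\<close> in the one lifting and by \<open>1 - z \<ge> 0\<close> in the other, so
  enlarging it strengthens the inequality in both.  Hence any upper bound \<open>\<gamma>\<close> of \<open>\<alpha>\<^sup>T x\<close> on the
  other polytope gives a consequence of the lifting, through the lower bound \<open>\<beta> - \<gamma>\<close> on the
  optimal coefficient.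
\<close>

lemma big_M_lifting0D:
  assumes "(x, z) \<in> big_M_lifting0 Q \<alpha> \<beta>" "Q \<noteq> {}" "0 \<le> z" "\<And>q. q \<in> Q \<Longrightarrow> \<alpha> \<bullet> q \<le> \<gamma>"
  shows "\<alpha> \<bullet> x \<le> (1 - z) * \<beta> + z * \<gamma>"
  using assms(1) mult_right_mono[OF opt_M_ge[of Q \<alpha> \<gamma> \<beta>, OF assms(2,4)] assms(3)]
  by (simp add: big_M_lifting0_def algebra_simps)

lemma big_M_lifting1D:
  assumes "(x, z) \<in> big_M_lifting1 Q \<alpha> \<beta>" "Q \<noteq> {}" "z \<le> 1" "\<And>q. q \<in> Q \<Longrightarrow> \<alpha> \<bullet> q \<le> \<gamma>"
  shows "\<alpha> \<bullet> x \<le> (1 - z) * \<gamma> + z * \<beta>"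
  using assms(1) mult_right_mono[OF opt_M_ge[of Q \<alpha> \<gamma> \<beta>, OF assms(2,4)], of "1 - z"] assms(3)
  by (simp add: big_M_lifting1_def algebra_simps)

section \<open>Facets of the two simplices\<close>

text \<open>
  If a point \<open>p\<close> satisfies exactly one of the defining inequalities with equality, the others
  are strict on a neighbourhood of \<open>p\<close>, where the polyhedron and its face therefore coincide
  with a halfspace and the bounding hyperplane.  Meeting an open set preserves the dimension of a
  convex set, so the polyhedron is full-dimensional and the face has codimension one.
\<close>

lemma facet_describing_if_only_tight:
  fixes \<alpha> :: "'k \<Rightarrow> 'a::euclidean_space"
  assumes P: "P = {x. \<forall>k\<in>K. \<alpha> k \<bullet> x \<le> \<beta> k}"
    and K: "finite K" "k0 \<in> K" and nz: "\<alpha> k0 \<noteq> 0"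
    and tight: "\<alpha> k0 \<bullet> p = \<beta> k0" and strict: "\<And>k. k \<in> K \<Longrightarrow> k \<noteq> k0 \<Longrightarrow> \<alpha> k \<bullet> p < \<beta> k"
  shows "facet_describing P (\<alpha> k0) (\<beta> k0)"
proof -
  define U where "U = (\<Inter>k\<in>K - {k0}. {x. \<alpha> k \<bullet> x < \<beta> k})"
  define F where "F = {x \<in> P. \<alpha> k0 \<bullet> x = \<beta> k0}"
  have U: "open U" "p \<in> U"
    using K strict by (auto simp: U_def open_halfspace_lt)
  have valid: "valid_ineq P (\<alpha> k0) (\<beta> k0)"
    using K by (auto simp: P valid_ineq_def)
  have "convex P"
    unfolding P by (auto intro!: convex_INT simp: Collect_ball_eq convex_halfspace_le)
  then have face: "F face_of P"
    using face_of_Int_supporting_hyperplane_le[of P "\<alpha> k0" "\<beta> k0"] valid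
    by (simp add: F_def valid_ineq_def Collect_conj_eq)
  have "{x. \<alpha> k0 \<bullet> x = \<beta> k0} \<inter> U \<subseteq> F"
    by (force simp: F_def P U_def)
  moreover have "aff_dim ({x. \<alpha> k0 \<bullet> x = \<beta> k0} \<inter> U) = DIM('a) - 1"
    using U tight nz
    by (subst aff_dim_convex_Int_open) (auto simp: convex_hyperplane)
  moreover have "aff_dim F \<le> aff_dim {x. \<alpha> k0 \<bullet> x = \<beta> k0}"
    by (rule aff_dim_subset) (auto simp: F_def)
  ultimately have dimF: "aff_dim F = DIM('a) - 1"
    using aff_dim_subset[of "{x. \<alpha> k0 \<bullet> x = \<beta> k0} \<inter> U" F] nz by simp
  have "{x. \<alpha> k0 \<bullet> x \<le> \<beta> k0} \<inter> U \<subseteq> P"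
    by (force simp: P U_def)
  moreover have "aff_dim ({x. \<alpha> k0 \<bullet> x \<le> \<beta> k0} \<inter> U) = DIM('a)"
  proof -
    have "p \<in> {x. \<alpha> k0 \<bullet> x \<le> \<beta> k0} \<inter> U"
      using U tight by simp
    then show ?thesis
      using U nz by (subst aff_dim_convex_Int_open) (auto simp: convex_halfspace_le aff_dim_halfspace_le)
  qed
  ultimately have dimP: "aff_dim P = DIM('a)"
    using aff_dim_subset[of "{x. \<alpha> k0 \<bullet> x \<le> \<beta> k0} \<inter> U" P] aff_dim_le_DIM[of P] by simp
  have "p \<in> F"
    using tight strict by (force simp: F_def P)
  then have "F facet_of P"
    using face dimF dimP by (auto simp: facet_of_def)
  then show ?thesis
    using valid by (simp add: facet_describing_def F_def)
qed

text \<open>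
  Outer normals of \<open>P\<^sub>0\<close>, with \<open>None\<close> for the bound on the coordinate sum; the outer normals of
  \<open>P\<^sub>1\<close> are their negatives.
\<close>

fun corner_normal :: "'n option \<Rightarrow> real ^ 'n" where
  "corner_normal None = (\<chi> i. - 1)"
| "corner_normal (Some i) = axis i 1"

fun corner_bound0 :: "real \<Rightarrow> real \<Rightarrow> 'n option \<Rightarrow> real" where
  "corner_bound0 a b None = a - real CARD('n) * b"
| "corner_bound0 a b (Some i) = b"

fun corner_bound1 :: "real \<Rightarrow> 'n option \<Rightarrow> real" where
  "corner_bound1 a None = a"
| "corner_bound1 a (Some i) = 0"

lemma inner_corner_normal [simp]:
  "corner_normal None \<bullet> x = - (\<Sum>i\<in>UNIV. x $ i)"
  "corner_normal (Some i) \<bullet> x = x $ i"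
  by (simp_all add: inner_vec_def[of "\<chi> i. - 1"] sum_negf inner_axis')

declare corner_normal.simps [simp del]

lemma corner_normal_nonzero: "corner_normal k \<noteq> (0 :: real ^ 'n)"
  by (cases k) (auto simp: corner_normal.simps vec_eq_iff axis_def)

lemma P0_eq_halfspaces:
  "P0 a b = {x :: real ^ 'n. \<forall>k\<in>UNIV. corner_normal k \<bullet> x \<le> corner_bound0 a b k}"
  by (auto simp: P0_def UNIV_option_conv)

lemma P1_eq_halfspaces:
  "P1 a = {x :: real ^ 'n. \<forall>k\<in>UNIV. (- corner_normal k) \<bullet> x \<le> corner_bound1 a k}"
  by (auto simp: P1_def UNIV_option_conv)

text \<open>
  The vector with all entries \<open>a / d\<close> lies in the relative interior of the facet of \<open>P\<^sub>1\<close> opposite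
  to the corner; replacing its \<open>i\<close>-th entry by \<open>0\<close> gives a relative interior point of the facet
  \<open>x\<^sub>i = 0\<close>.
\<close>

fun facet_point :: "real \<Rightarrow> 'n::finite option \<Rightarrow> real ^ 'n" where
  "facet_point a None = (\<chi> j. a / real CARD('n))"
| "facet_point a (Some i) = (\<chi> j. if j = i then 0 else a / real CARD('n))"

lemma sum_facet_point:
  "(\<Sum>j\<in>UNIV. facet_point a None $ j) = a"
  "(\<Sum>j\<in>UNIV. facet_point a (Some (i :: 'n::finite)) $ j) = a - a / real CARD('n)"
proof -
  show "(\<Sum>j\<in>UNIV. facet_point a (Some (i :: 'n::finite)) $ j) = a - a / real CARD('n)"
    by (simp add: sum.delta_remove sum.remove[of UNIV i] card_Diff_singleton of_nat_diff
        Suc_leI field_simps)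
qed simp

lemma facet_describing_P1:
  assumes "a > 0"
  shows "facet_describing (P1 a) (- corner_normal k :: real ^ 'n) (corner_bound1 a k)"
proof (rule facet_describing_if_only_tight[OF P1_eq_halfspaces, of k "facet_point a k"])
  show "- corner_normal k \<noteq> (0 :: real ^ 'n)"
    by (simp add: corner_normal_nonzero)
  show "(- corner_normal k) \<bullet> facet_point a k = corner_bound1 a k"
    by (cases k) (simp_all add: sum_facet_point del: facet_point.simps, simp)
  show "(- corner_normal l) \<bullet> facet_point a k < corner_bound1 a l" if "l \<noteq> k" for l
    using that assms
    by (cases k; cases l) (auto simp: sum_facet_point simp del: facet_point.simps, auto)
qed simp_all

lemma facet_describing_P0:
  assumes "a > 0"
  shows "facet_describing (P0 a b) (corner_normal k :: real ^ 'n) (corner_bound0 a b k)"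
proof (rule facet_describing_if_only_tight[OF P0_eq_halfspaces, of k "(\<chi> i. b) - facet_point a k"])
  show "corner_normal k \<bullet> ((\<chi> i. b) - facet_point a k) = corner_bound0 a b k"
    by (cases k)
      (simp_all add: sum_subtractf sum_facet_point del: facet_point.simps, simp)
  show "corner_normal l \<bullet> ((\<chi> i. b) - facet_point a k) < corner_bound0 a b l" if "l \<noteq> k" for l
    using that assms
    by (cases k; cases l)
      (auto simp: sum_subtractf sum_facet_point simp del: facet_point.simps, auto)
qed (simp_all add: corner_normal_nonzero)

section \<open>Subset sums\<close>

lemma P1_subset_sum_bounds:
  assumes "x \<in> P1 a"
  shows "0 \<le> (\<Sum>i\<in>T. x $ i)" "(\<Sum>i\<in>T. x $ i) \<le> a"
proof -
  show "0 \<le> (\<Sum>i\<in>T. x $ i)"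
    using assms by (auto simp: P1_def intro: sum_nonneg)
  have "(\<Sum>i\<in>T. x $ i) \<le> (\<Sum>i\<in>UNIV. x $ i)"
    using assms by (intro sum_mono2) (auto simp: P1_def)
  then show "(\<Sum>i\<in>T. x $ i) \<le> a"
    using assms by (simp add: P1_def)
qed

lemma P0_iff_reflected_P1: "x \<in> P0 a b \<longleftrightarrow> (\<chi> i. b) - x \<in> P1 a"
  by (auto simp: P0_def P1_def sum_subtractf)

lemma P0_subset_sum_bounds:
  assumes "x \<in> P0 a b"
  shows "(\<Sum>i\<in>T. x $ i) \<le> real (card T) * b" "real (card T) * b - a \<le> (\<Sum>i\<in>T. x $ i)"
  using P1_subset_sum_bounds[OF assms[unfolded P0_iff_reflected_P1], of T]
  by (simp_all add: sum_subtractf)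

lemma bounded_P1: "bounded (P1 a :: (real ^ 'n) set)"
proof (rule boundedI)
  fix x :: "real ^ 'n" assume "x \<in> P1 a"
  then show "norm x \<le> a"
    using norm_le_l1_cart[of x] by (auto simp: P1_def)
qed

lemma bounded_P0: "bounded (P0 a b :: (real ^ 'n) set)"
proof -
  have "P0 a b = (\<lambda>y. (\<chi> i. b) - y) ` (P1 a :: (real ^ 'n) set)"
    by (force simp: P0_iff_reflected_P1 image_iff)
  also have "bounded \<dots>"
    using bounded_translation[OF iffD2[OF bounded_uminus bounded_P1], of "\<chi> i. b" a]
    by (simp add: image_image)
  finally show ?thesis .
qed

text \<open>
  Only two index sets matter for a given point: the sets where \<open>x - (1 - z) b\<close> is positive and
  negative, respectively.
\<close>

lemma in_disj_hull_if_subset_sums: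
  fixes x :: "real ^ 'n"
  assumes z: "0 \<le> z" "z \<le> 1"
    and upper: "\<And>T. (\<Sum>i\<in>T. x $ i) \<le> (1 - z) * (real (card T) * b) + z * a"
    and lower: "\<And>T. - (\<Sum>i\<in>T. x $ i) \<le> (1 - z) * (a - real (card T) * b)"
  shows "(x, z) \<in> disj_hull (P0 a b) (P1 a)"
proof -
  define y where "y = x - (\<chi> i. (1 - z) * b)"
  define v u :: "real ^ 'n" where "v = (\<chi> i. max (y $ i) 0)" and "u = (\<chi> i. max (- y $ i) 0)"
  have sum_y: "(\<Sum>i\<in>T. y $ i) = (\<Sum>i\<in>T. x $ i) - real (card T) * ((1 - z) * b)" for T
    by (simp add: y_def sum_subtractf)
  have sum_v: "(\<Sum>i\<in>UNIV. v $ i) \<le> z * a"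
  proof -
    have "(\<Sum>i\<in>UNIV. v $ i) = (\<Sum>i | y $ i > 0. y $ i)"
      by (rule sum.mono_neutral_cong_right) (auto simp: v_def max_def)
    also have "\<dots> \<le> z * a"
      using upper[of "{i. y $ i > 0}"] by (simp add: sum_y mult_ac)
    finally show ?thesis .
  qed
  have sum_u: "(\<Sum>i\<in>UNIV. u $ i) \<le> (1 - z) * a"
  proof -
    have "(\<Sum>i\<in>UNIV. u $ i) = (\<Sum>i | y $ i < 0. - y $ i)"
      by (rule sum.mono_neutral_cong_right) (auto simp: u_def max_def)
    also have "\<dots> \<le> (1 - z) * a"
      using lower[of "{i. y $ i < 0}"] by (simp add: sum_y sum_negf algebra_simps)
    finally show ?thesis .
  qed
  have pos: "0 \<le> u $ i" "0 \<le> v $ i" for i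
    by (simp_all add: u_def v_def)
  \<comment> \<open>Since \<open>1 / 0 = 0\<close>, rescaling also works for \<open>c = 0\<close>, where the sum bound forces \<open>w = 0\<close>.\<close>
  have scaled: "(1 / c) *\<^sub>R w \<in> P1 a" "c *\<^sub>R ((1 / c) *\<^sub>R w) = w"
    if c: "0 \<le> c" and w: "\<And>i. 0 \<le> w $ i" "(\<Sum>i\<in>UNIV. w $ i) \<le> c * a" for c and w :: "real ^ 'n"
  proof -
    have "w = 0" if "c = 0"
    proof -
      have "(\<Sum>i\<in>UNIV. w $ i) = 0"
        using w that by (simp add: antisym sum_nonneg)
      then show ?thesis
        using w(1) by (simp add: sum_nonneg_eq_0_iff vec_eq_iff)
    qed
    then show "c *\<^sub>R ((1 / c) *\<^sub>R w) = w"
      by auto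
    have "0 \<le> a"
      using lower[of "{}"] upper[of "{}"] z by (simp add: algebra_simps)
    then have "(\<Sum>i\<in>UNIV. w $ i) / c \<le> a"
      using c w(2) by (cases "c = 0") (auto simp: field_simps)
    then show "(1 / c) *\<^sub>R w \<in> P1 a"
      using c w(1) by (simp add: P1_def flip: sum_divide_distrib)
  qed
  let ?p = "(\<chi> i. b) - (1 / (1 - z)) *\<^sub>R u" and ?q = "(1 / z) *\<^sub>R v"
  have "?p \<in> P0 a b"
    using scaled(1)[of "1 - z" u] z pos sum_u by (simp add: P0_iff_reflected_P1)
  moreover have "?q \<in> P1 a"
    using scaled(1)[of z v] z pos sum_v by simp
  moreover have "(1 - z) *\<^sub>R ?p + z *\<^sub>R ?q = x"
  proof -
    have "(1 - z) *\<^sub>R ?p + z *\<^sub>R ?q = (1 - z) *\<^sub>R (\<chi> i. b) - u + v"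
      using scaled(2)[of "1 - z" u] scaled(2)[of z v] z pos sum_u sum_v
      by (simp only: scaleR_diff_right)
    also have "\<dots> = x"
      by (simp add: vec_eq_iff u_def v_def y_def max_def)
    finally show ?thesis .
  qed
  ultimately show ?thesis
    using in_disj_hullI[of ?p "P0 a b" ?q "P1 a" z] z by simp
qed

section \<open>The description of the hull\<close>

theorem theorem13:
  fixes a b :: real and d :: nat
  assumes "d = CARD('n::finite)" and "d \<ge> 3" and "a > 0"
  shows "disj_hull (P0 a b :: (real ^ 'n) set) (P1 a) =
    {(x, z\<^sub>1).
       (\<forall>\<alpha> \<beta>. facet_describing (P0 a b) \<alpha> \<beta> \<longrightarrow> (x, z\<^sub>1) \<in> big_M_lifting0 (P1 a) \<alpha> \<beta>) \<and>
       (\<forall>\<alpha> \<beta>. facet_describing (P1 a) \<alpha> \<beta> \<longrightarrow> (x, z\<^sub>1) \<in> big_M_lifting1 (P0 a b) \<alpha> \<beta>) \<and>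
       0 \<le> z\<^sub>1 \<and> z\<^sub>1 \<le> 1 \<and>
       (\<forall>m T\<^sub>0. 2 \<le> m \<and> m \<le> d - 1 \<and> card T\<^sub>0 = d + 1 - m \<longrightarrow>
          - (\<Sum>i\<in>T\<^sub>0. x $ i) + (a - real (d + 1 - m) * b) * z\<^sub>1 \<le> a - real (d + 1 - m) * b) \<and>
       (\<forall>m T\<^sub>1. 2 \<le> m \<and> m \<le> d - 1 \<and> card T\<^sub>1 = m \<longrightarrow>
          (\<Sum>i\<in>T\<^sub>1. x $ i) + (real m * b - a) * z\<^sub>1 \<le> real m * b)}"
proof (intro set_eqI iffI; clarify)
  fix x :: "real ^ 'n" and z
  assume hull: "(x, z) \<in> disj_hull (P0 a b) (P1 a)"
  have sums: "linear (\<lambda>x :: real ^ 'n. \<Sum>i\<in>T. x $ i)" for T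
    by (rule linearI) (simp_all add: sum.distrib sum_distrib_left)
  have upper: "(\<Sum>i\<in>T. x $ i) \<le> (1 - z) * (real (card T) * b) + z * a" for T
    by (rule disj_hull_linear_le[OF hull sums]) (auto dest: P0_subset_sum_bounds P1_subset_sum_bounds)
  have lower: "- (\<Sum>i\<in>T. x $ i) \<le> (1 - z) * (a - real (card T) * b) + z * 0" for T
    by (rule disj_hull_linear_le[OF hull linear_compose_neg[OF sums]])
      (use P0_subset_sum_bounds(2)[of _ a b T] P1_subset_sum_bounds(1)[of _ a T] in \<open>force+\<close>)
  have "0 \<le> z * a" "0 \<le> (1 - z) * a"
    using upper[of "{}"] lower[of "{}"] by simp_all
  then have z: "0 \<le> z" "z \<le> 1"
    using \<open>a > 0\<close> by (simp_all add: zero_le_mult_iff)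
  have iv: "(\<Sum>i\<in>T. x $ i) + (real m * b - a) * z \<le> real m * b" if "card T = m" for m T
    using upper[of T] that by (simp add: algebra_simps)
  have iii: "- (\<Sum>i\<in>T. x $ i) + (a - real m * b) * z \<le> a - real m * b" if "card T = m" for m T
    using lower[of T] that by (simp add: algebra_simps)
  show
      "(\<forall>\<alpha> \<beta>. facet_describing (P0 a b) \<alpha> \<beta> \<longrightarrow> (x, z) \<in> big_M_lifting0 (P1 a) \<alpha> \<beta>) \<and>
       (\<forall>\<alpha> \<beta>. facet_describing (P1 a) \<alpha> \<beta> \<longrightarrow> (x, z) \<in> big_M_lifting1 (P0 a b) \<alpha> \<beta>) \<and>
       0 \<le> z \<and> z \<le> 1 \<and>
       (\<forall>m T\<^sub>0. 2 \<le> m \<and> m \<le> d - 1 \<and> card T\<^sub>0 = d + 1 - m \<longrightarrow>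
          - (\<Sum>i\<in>T\<^sub>0. x $ i) + (a - real (d + 1 - m) * b) * z \<le> a - real (d + 1 - m) * b) \<and>
       (\<forall>m T\<^sub>1. 2 \<le> m \<and> m \<le> d - 1 \<and> card T\<^sub>1 = m \<longrightarrow>
          (\<Sum>i\<in>T\<^sub>1. x $ i) + (real m * b - a) * z \<le> real m * b)"
    by (intro conjI allI impI z)
      (simp_all only: facet_describing_def iii iv disj_hull_big_M_lifting0[OF hull _ bounded_P1]
          disj_hull_big_M_lifting1[OF hull _ bounded_P0])
next
  fix x :: "real ^ 'n" and z
  assume lift0: "\<forall>\<alpha> \<beta>. facet_describing (P0 a b) \<alpha> \<beta> \<longrightarrow> (x, z) \<in> big_M_lifting0 (P1 a) \<alpha> \<beta>"
    and lift1: "\<forall>\<alpha> \<beta>. facet_describing (P1 a) \<alpha> \<beta> \<longrightarrow> (x, z) \<in> big_M_lifting1 (P0 a b) \<alpha> \<beta>"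
    and z: "0 \<le> z" "z \<le> 1"
    and iii: "\<forall>m T\<^sub>0. 2 \<le> m \<and> m \<le> d - 1 \<and> card T\<^sub>0 = d + 1 - m \<longrightarrow>
          - (\<Sum>i\<in>T\<^sub>0. x $ i) + (a - real (d + 1 - m) * b) * z \<le> a - real (d + 1 - m) * b"
    and iv: "\<forall>m T\<^sub>1. 2 \<le> m \<and> m \<le> d - 1 \<and> card T\<^sub>1 = m \<longrightarrow>
          (\<Sum>i\<in>T\<^sub>1. x $ i) + (real m * b - a) * z \<le> real m * b"
  have "(0 :: real ^ 'n) \<in> P1 a"
    using \<open>a > 0\<close> by (simp add: P1_def)
  then have ne: "P1 a \<noteq> ({} :: (real ^ 'n) set)" "P0 a b \<noteq> ({} :: (real ^ 'n) set)"
    using P0_iff_reflected_P1[of "\<chi> i. b" a b] by auto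
  note lifted0 = big_M_lifting0D[OF lift0[rule_format, OF facet_describing_P0[OF \<open>a > 0\<close>]] ne(1) z(1)]
  note lifted1 = big_M_lifting1D[OF lift1[rule_format, OF facet_describing_P1[OF \<open>a > 0\<close>]] ne(2) z(2)]
  have upper1: "x $ i \<le> (1 - z) * b + z * a" for i
    using lifted0[of "Some i" a] P1_subset_sum_bounds(2)[of _ a "{i}"] by simp
  have lower_all: "- (\<Sum>i\<in>UNIV. x $ i) \<le> (1 - z) * (a - real d * b)"
    using lifted0[of None 0] P1_subset_sum_bounds(1)[of _ a "UNIV :: 'n set"] \<open>d = CARD('n)\<close> by simp
  have lower1: "- x $ i \<le> (1 - z) * (a - b)" for i
  proof -
    have "- q $ i \<le> a - b" if "q \<in> P0 a b" for q :: "real ^ 'n"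
      using P0_subset_sum_bounds(2)[OF that, of "{i}"] by simp
    then show ?thesis
      using lifted1[of "Some i" "a - b"] by simp
  qed
  have upper_all: "(\<Sum>i\<in>UNIV. x $ i) \<le> (1 - z) * (real d * b) + z * a"
    using lifted1[of None "real d * b"] P0_subset_sum_bounds(1)[of _ a b "UNIV :: 'n set"] \<open>d = CARD('n)\<close>
    by simp
  have sizes: "T = {} \<or> (\<exists>i. T = {i}) \<or> T = UNIV \<or> 2 \<le> card T \<and> card T \<le> d - 1" for T :: "'n set"
  proof -
    have "card T < d" if "T \<noteq> UNIV"
      using that psubset_card_mono[of UNIV T] \<open>d = CARD('n)\<close> by auto
    then have "card T = 0 \<or> card T = 1 \<or> T = UNIV \<or> 2 \<le> card T \<and> card T \<le> d - 1"
      by linarith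
    then show ?thesis
      by (auto simp: card_1_singleton_iff)
  qed
  show "(x, z) \<in> disj_hull (P0 a b) (P1 a)"
  proof (rule in_disj_hull_if_subset_sums[OF z])
    fix T :: "'n set"
    consider "T = {}" | i where "T = {i}" | "T = UNIV" | "2 \<le> card T" "card T \<le> d - 1"
      using sizes by blast
    note size_cases = this
    show "(\<Sum>i\<in>T. x $ i) \<le> (1 - z) * (real (card T) * b) + z * a"
    proof (cases rule: size_cases)
      case 1
      then show ?thesis using z \<open>a > 0\<close> by simp
    next
      case 2
      then show ?thesis using upper1 by simp
    next
      case 3
      then show ?thesis using upper_all \<open>d = CARD('n)\<close> by simp
    next
      case 4
      then show ?thesis using iv[rule_format, of "card T" T] by (simp add: algebra_simps)
    qed
    show "- (\<Sum>i\<in>T. x $ i) \<le> (1 - z) * (a - real (card T) * b)"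
    proof (cases rule: size_cases)
      case 1
      then show ?thesis using z \<open>a > 0\<close> by simp
    next
      case 2
      then show ?thesis using lower1 by simp
    next
      case 3
      then show ?thesis using lower_all \<open>d = CARD('n)\<close> by simp
    next
      case 4
      \<comment> \<open>The lower bounds are indexed by \<open>m = d + 1 - |T|\<close>, which exchanges the sizes \<open>2\<close> and \<open>d - 1\<close>.\<close>
      then have m: "2 \<le> d + 1 - card T" "d + 1 - card T \<le> d - 1" "d + 1 - (d + 1 - card T) = card T"
        using \<open>d \<ge> 3\<close> by auto
      then show ?thesis
        using iii[rule_format, of "d + 1 - card T" T] unfolding m(3) by (simp add: algebra_simps)
    qed
  qed
qed

end
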